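(* Let $p$ be a probability density on $\mathbb{R}^d$ with compact support, let $R=\mathrm{Ridge}(p)$ be its (one-dimensional) ridge set, also called its filament set, and let $\phi:[0,1]\to R$ be a parametrization of $R$. For $s_0\in[0,1]$, let $U\subset R$ be an open set (open in $R$) containing $\phi(s_0)$. If $p$ is $\mathbf{C}^k$ and the eigengap satisfies $\beta(x)>0$ for all $x\in U$, then $\phi(s)$ is $\mathbf{C}^{k-2}$ for $s\in\phi^{-1}(U)$.
   Context: $\mathbf{C}^k$ denotes the class of $k$ times continuously differentiable functions. For a density $p$ on $\mathbb{R}^d$ ($d\ge 2$), $H(x)$ is the Hessian of $p$ at $x$, with eigenvalues $\lambda_1(x)\ge\lambda_2(x)\ge\cdots\ge\lambda_d(x)$ and corresponding orthonormal eigenvectors $v_1(x),\dots,v_d(x)$. Put $V(x)=[v_2(x),\dots,v_d(x)]$ (a $d\times(d-1)$ matrix), $G(x)=V(x)V(x)^T\nabla p(x)$, and $$\mathrm{Ridge}(p)=\{x: G(x)=0,\ \lambda_2(x)<0\}.$$ The eigengap is $\beta(x)=\lambda_1(x)-\lambda_2(x)$. Standing assumptions: the ridge set can be decomposed into finitely many pieces, each a one-dimensional manifold, and for simplicity $R$ is taken to be a single such piece. The parametrization $\phi:[0,1]\to R$ of $R$ is the one obtained by traversing the ridge, with the parameter suitably scaled to $[0,1]$: writing $F(x)=V(x)^T\nabla p(x)\in\mathbb{R}^{d-1}$ (with the columns of $V$ chosen locally as a smooth orthonormal frame of the span of $v_2,\dots,v_d$, as smooth as $H$ permits; $F=0$ is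 equivalent to $G=0$), $\phi$ moves along the level set $F=0$ and, where $F$ is continuously differentiable, solves the traversal equation $\phi'(s)=c\,T(\phi(s))$, where $T(x)$ is the generalized cross product in $\mathbb{R}^d$ of the $d-1$ rows of the Jacobian $DF(x)$ (defined up to sign, with the sign chosen continuously along the curve) and $c\neq0$ is a scaling constant. *)

theory Defs
  imports "HOL-Analysis.Analysis"
begin

text \<open>
  Class \<open>C\<^sup>m\<close> on \<open>S\<close>, through iterated directional derivatives (the domain is
  finite-dimensional, so this is the usual notion). It is meant for \<open>S\<close> open, or \<open>S\<close> relatively
  open in a nondegenerate interval of the reals (one-sided derivatives at the end points); for
  such \<open>S\<close> the derivative \<open>f'\<close> is unique.
\<close>

primrec Ck_on ::
  "nat \<Rightarrow> ('a::euclidean_space \<Rightarrow> 'b::real_normed_vector) \<Rightarrow> 'a set \<Rightarrow> bool" where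
  "Ck_on 0 f S \<longleftrightarrow> continuous_on S f"
| "Ck_on (Suc m) f S \<longleftrightarrow>
     (\<exists>f'. (\<forall>x\<in>S. (f has_derivative f' x) (at x within S)) \<and> (\<forall>h. Ck_on m (\<lambda>x. f' x h) S))"

definition prob_density :: "(real ^ 'n \<Rightarrow> real) \<Rightarrow> bool" where
  "prob_density p \<longleftrightarrow>
     p \<in> borel_measurable borel \<and> (\<forall>x. 0 \<le> p x) \<and> (\<integral>\<^sup>+ x. ennreal (p x) \<partial>lborel) = 1"

definition grad :: "(real ^ 'n \<Rightarrow> real) \<Rightarrow> real ^ 'n \<Rightarrow> real ^ 'n" where
  "grad f x = (\<chi> i. frechet_derivative f (at x) (axis i 1))"

definition hessian :: "(real ^ 'n \<Rightarrow> real) \<Rightarrow> real ^ 'n \<Rightarrow> real ^ 'n ^ 'n" where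
  "hessian p x = matrix (frechet_derivative (grad p) (at x))"

text \<open>
  Eigenvalues and eigenvectors are indexed by \<open>1, \<dots>, d\<close> with \<open>d = CARD('n)\<close>. The family \<open>v\<close> is
  an arbitrary pointwise choice of orthonormal eigenvectors, with no regularity in \<open>x\<close>.
  Since the eigenvectors form an orthonormal basis, each eigenvalue occurs in \<open>\<lambda>\<close> according to its
  multiplicity.
\<close>

definition ordered_eigensystem ::
  "(real ^ 'n \<Rightarrow> real ^ 'n ^ 'n) \<Rightarrow> (nat \<Rightarrow> real ^ 'n \<Rightarrow> real) \<Rightarrow> (nat \<Rightarrow> real ^ 'n \<Rightarrow> real ^ 'n) \<Rightarrow> bool"
  where
  "ordered_eigensystem H lam v \<longleftrightarrow> (\<forall>x.
     (\<forall>i\<in>{1..CARD('n)}. H x *v v i x = lam i x *\<^sub>R v i x) \<and>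
     (\<forall>i\<in>{1..CARD('n)}. \<forall>j\<in>{1..CARD('n)}. v i x \<bullet> v j x = (if i = j then 1 else 0)) \<and>
     (\<forall>i\<in>{1..CARD('n)}. \<forall>j\<in>{1..CARD('n)}. i \<le> j \<longrightarrow> lam j x \<le> lam i x))"

definition eigengap :: "(nat \<Rightarrow> real ^ 'n \<Rightarrow> real) \<Rightarrow> real ^ 'n \<Rightarrow> real" where
  "eigengap lam x = lam 1 x - lam 2 x"

text \<open>
  This is \<open>V V\<^sup>T \<nabla>p\<close>, written in terms of the columns \<open>v\<^sub>2, \<dots>, v\<^sub>d\<close> of \<open>V\<close>.
\<close>

definition projected_grad ::
  "(real ^ 'n \<Rightarrow> real) \<Rightarrow> (nat \<Rightarrow> real ^ 'n \<Rightarrow> real ^ 'n) \<Rightarrow> real ^ 'n \<Rightarrow> real ^ 'n" where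
  "projected_grad p v x = (\<Sum>i\<in>{2..CARD('n)}. (v i x \<bullet> grad p x) *\<^sub>R v i x)"

definition ridge ::
  "(real ^ 'n \<Rightarrow> real) \<Rightarrow> (nat \<Rightarrow> real ^ 'n \<Rightarrow> real) \<Rightarrow> (nat \<Rightarrow> real ^ 'n \<Rightarrow> real ^ 'n) \<Rightarrow> (real ^ 'n) set"
  where
  "ridge p lam v = {x. projected_grad p v x = 0 \<and> lam 2 x < 0}"

text \<open>One-dimensional topological manifold, possibly with boundary.\<close>

definition one_manifold :: "(real ^ 'n) set \<Rightarrow> bool" where
  "one_manifold M \<longleftrightarrow> (\<forall>x\<in>M. \<exists>N S. openin (top_of_set M) N \<and> x \<in> N \<and>
     openin (top_of_set {0::real..}) S \<and> N homeomorphic S)"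

text \<open>
  A local frame \<open>E\<^sub>2, \<dots>, E\<^sub>d\<close> of class \<open>C\<^sup>m\<close> on \<open>W\<close> for the span of \<open>v\<^sub>2, \<dots>, v\<^sub>d\<close>.
\<close>

definition local_frame ::
  "nat \<Rightarrow> (nat \<Rightarrow> real ^ 'n \<Rightarrow> real ^ 'n) \<Rightarrow> (real ^ 'n) set \<Rightarrow> (nat \<Rightarrow> real ^ 'n \<Rightarrow> real ^ 'n) \<Rightarrow> bool"
  where
  "local_frame m v W E \<longleftrightarrow>
     open W \<and>
     (\<forall>i\<in>{2..CARD('n)}. Ck_on m (E i) W) \<and>
     (\<forall>x\<in>W. (\<forall>i\<in>{2..CARD('n)}. \<forall>j\<in>{2..CARD('n)}. E i x \<bullet> E j x = (if i = j then 1 else 0)) \<and>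
        span ((\<lambda>i. E i x) ` {2..CARD('n)}) = span ((\<lambda>i. v i x) ` {2..CARD('n)}))"

text \<open>
  The components \<open>F\<^sub>2, \<dots>, F\<^sub>d\<close> of \<open>F = V\<^sup>T \<nabla>p\<close>, for \<open>V\<close> with columns \<open>E\<^sub>2, \<dots>, E\<^sub>d\<close>.
\<close>

definition ridge_fun ::
  "(real ^ 'n \<Rightarrow> real) \<Rightarrow> (nat \<Rightarrow> real ^ 'n \<Rightarrow> real ^ 'n) \<Rightarrow> nat \<Rightarrow> real ^ 'n \<Rightarrow> real" where
  "ridge_fun p E i x = E i x \<bullet> grad p x"

text \<open>
  The generalized cross product of the \<open>d - 1\<close> vectors \<open>r\<^sub>2, \<dots>, r\<^sub>d\<close>: its \<open>j\<close>-th component is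
  the determinant of the matrix with rows \<open>e\<^sub>j, r\<^sub>2, \<dots>, r\<^sub>d\<close>. The rows of a matrix are indexed by
  the unordered type \<open>'n\<close>, so they are numbered \<open>1, \<dots>, d\<close> through the library's enumeration
  \<open>to_nat_on UNIV\<close>, a bijection onto \<open>{0..<d}\<close>; another enumeration changes at most the sign.
\<close>

definition gen_cross :: "(nat \<Rightarrow> real ^ 'n) \<Rightarrow> real ^ 'n" where
  "gen_cross r = (\<chi> j. det (\<chi> a. let i = Suc (to_nat_on (UNIV :: 'n set) a)
                               in if i = 1 then axis j 1 else r i))"

definition ridge_tangent ::
  "(real ^ 'n \<Rightarrow> real) \<Rightarrow> (nat \<Rightarrow> real ^ 'n \<Rightarrow> real ^ 'n) \<Rightarrow> real ^ 'n \<Rightarrow> real ^ 'n" where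
  "ridge_tangent p E x = gen_cross (\<lambda>i. grad (ridge_fun p E i) x)"

text \<open>
  The traversal equation \<open>\<phi>' = c T(\<phi>)\<close>, imposed near every parameter \<open>s\<close> and in every local frame
  (of the class \<open>C\<^bsup>k-2\<^esup>\<close> of the Hessian) around \<open>\<phi> s\<close> for which \<open>F\<close> is \<open>C\<^sup>1\<close>. A change of
  frame by an orthogonal matrix \<open>Q\<close> multiplies \<open>T\<close> by \<open>det Q = \<plusminus>1\<close> at points with \<open>F = 0\<close>;
  relative to a continuous frame, a continuous choice of sign along the curve is a locally
  constant \<open>\<sigma>\<close>. The constant \<open>c\<close> is the same for the whole curve.
\<close>

definition traverses ::
  "nat \<Rightarrow> (real ^ 'n \<Rightarrow> real) \<Rightarrow> (nat \<Rightarrow> real ^ 'n \<Rightarrow> real ^ 'n) \<Rightarrow> real \<Rightarrow> (real \<Rightarrow> real ^ 'n) \<Rightarrow> bool"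
  where
  "traverses k p v c \<phi> \<longleftrightarrow> (\<forall>s\<in>{0..1}. \<forall>W E.
     \<phi> s \<in> W \<and> local_frame (k - 2) v W E \<and> (\<forall>i\<in>{2..CARD('n)}. Ck_on 1 (ridge_fun p E i) W) \<longrightarrow>
     (\<exists>\<sigma>\<in>{-1, 1}. \<exists>\<delta>>0. \<forall>t\<in>{0..1}. \<bar>t - s\<bar> < \<delta> \<longrightarrow>
        (\<phi> has_vector_derivative (c * \<sigma>) *\<^sub>R ridge_tangent p E (\<phi> t)) (at t within {0..1})))"

definition ridge_parametrization ::
  "nat \<Rightarrow> (real ^ 'n \<Rightarrow> real) \<Rightarrow> (nat \<Rightarrow> real ^ 'n \<Rightarrow> real ^ 'n) \<Rightarrow> (real ^ 'n) set \<Rightarrow> (real \<Rightarrow> real ^ 'n) \<Rightarrow> bool"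
  where
  "ridge_parametrization k p v R \<phi> \<longleftrightarrow>
     path \<phi> \<and> path_image \<phi> = R \<and> (\<exists>c. c \<noteq> 0 \<and> traverses k p v c \<phi>)"

end

theory Submission
  imports Defs
begin

text \<open>
  Near a point where \<open>\<lambda>\<^sub>1 > \<lambda>\<^sub>2\<close> the top eigenspace of the Hessian \<open>H\<close> varies as smoothly as \<open>H\<close>,
  and reflecting a fixed eigenbasis gives a \<open>C\<^bsup>k-2\<^esup>\<close> orthonormal frame of its orthogonal
  complement. In this frame \<open>F\<close> is \<open>C\<^bsup>k-2\<^esup>\<close>, so \<open>T\<close> is \<open>C\<^bsup>k-3\<^esup>\<close>, and a solution of
  \<open>\<phi>' = c T(\<phi>)\<close> is one order smoother than \<open>T\<close>.

  To smooth the eigenvector, let \<open>u\<^sub>0\<close> be the unit top eigenvector at the base point. The matrix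
  \<open>M = H - \<lambda>\<^sub>1 I - u\<^sub>0 u\<^sub>0\<^sup>T\<close> is invertible nearby, and the solution \<open>w\<close> of \<open>M w = -u\<^sub>0\<close> is the top
  eigenvector with \<open>u\<^sub>0 \<bullet> w = 1\<close>. By Cramer's rule \<open>w\<close> is as smooth as \<open>\<lambda>\<^sub>1\<close> and \<open>H\<close> permit, and
  \<open>D\<lambda>\<^sub>1 h = w \<bullet> (DH h) w / w \<bullet> w\<close> makes \<open>\<lambda>\<^sub>1\<close> one order smoother than \<open>w\<close> as long as \<open>DH\<close>
  permits; iterating from continuity of \<open>\<lambda>\<^sub>1\<close> yields the full smoothness.
\<close>

subsection \<open>Calculus of the classes \<open>C\<^sup>m\<close>\<close>

lemma Ck_on_SucI:
  assumes "\<And>x. x \<in> S \<Longrightarrow> (f has_derivative f' x) (at x within S)"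
    and "\<And>h. Ck_on m (\<lambda>x. f' x h) S"
  shows "Ck_on (Suc m) f S"
  using assms by auto

lemma Ck_on_SucE:
  assumes "Ck_on (Suc m) f S"
  obtains f' where "\<And>x. x \<in> S \<Longrightarrow> (f has_derivative f' x) (at x within S)"
    and "\<And>h. Ck_on m (\<lambda>x. f' x h) S"
  using assms by auto

lemma Ck_on_SucD: "Ck_on (Suc m) f S \<Longrightarrow> Ck_on m f S"
proof (induction m arbitrary: f)
  case 0
  then show ?case
    by (auto simp: continuous_on_eq_continuous_within intro: has_derivative_continuous)
next
  case (Suc m)
  obtain f' where "\<And>x. x \<in> S \<Longrightarrow> (f has_derivative f' x) (at x within S)"
    and "\<And>h. Ck_on (Suc m) (\<lambda>x. f' x h) S"
    using Suc.prems by (rule Ck_on_SucE) blast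
  with Suc.IH show ?case by (intro Ck_on_SucI[of _ _ f']) blast+
qed

lemma Ck_on_le:
  assumes "j \<le> m" "Ck_on m f S"
  shows "Ck_on j f S"
  using assms by (induction rule: dec_induct) (blast dest: Ck_on_SucD)+

lemma Ck_on_imp_continuous_on: "Ck_on m f S \<Longrightarrow> continuous_on S f"
  using Ck_on_le[of 0 m f S] by simp

lemma Ck_on_subset: "Ck_on m f S \<Longrightarrow> T \<subseteq> S \<Longrightarrow> Ck_on m f T"
proof (induction m arbitrary: f)
  case 0
  then show ?case by (auto intro: continuous_on_subset)
next
  case (Suc m)
  obtain f' where "\<And>x. x \<in> S \<Longrightarrow> (f has_derivative f' x) (at x within S)"
    and "\<And>h. Ck_on m (\<lambda>x. f' x h) S"
    using Suc.prems(1) by (rule Ck_on_SucE) blast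
  with Suc show ?case
    by (intro Ck_on_SucI[of _ _ f']) (blast intro: has_derivative_subset)+
qed

lemma Ck_on_cong:
  assumes "Ck_on m f S" "\<And>x. x \<in> S \<Longrightarrow> g x = f x"
  shows "Ck_on m g S"
proof (cases m)
  case 0
  with assms show ?thesis by (simp cong: continuous_on_cong)
next
  case (Suc n)
  then obtain f' where "\<And>x. x \<in> S \<Longrightarrow> (f has_derivative f' x) (at x within S)"
    and "\<And>h. Ck_on n (\<lambda>x. f' x h) S"
    using assms(1) by (auto elim: Ck_on_SucE)
  with assms(2) show ?thesis
    unfolding Suc by (intro Ck_on_SucI[of _ _ f']) (blast intro: has_derivative_transform)+
qed

section \<open>Closure of the class \<open>C^m\<close> under algebraic operations\<close>

lemma Ck_on_const: "Ck_on m (\<lambda>x. c) S"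
proof (induction m arbitrary: c)
  case (Suc m)
  show ?case by (rule Ck_on_SucI[of _ _ "\<lambda>x h. 0"]) (auto intro: Suc)
qed simp

lemma Ck_on_bounded_linear:
  assumes "bounded_linear L" "Ck_on m f S"
  shows "Ck_on m (\<lambda>x. L (f x)) S"
  using assms(2)
proof (induction m arbitrary: f)
  case 0
  then show ?case using assms(1) by (simp add: bounded_linear.continuous_on)
next
  case (Suc m)
  obtain f' where "\<And>x. x \<in> S \<Longrightarrow> (f has_derivative f' x) (at x within S)"
    and "\<And>h. Ck_on m (\<lambda>x. f' x h) S"
    using Suc.prems by (rule Ck_on_SucE) blast
  with Suc.IH show ?case
    by (intro Ck_on_SucI[of _ _ "\<lambda>x h. L (f' x h)"])
      (auto intro: bounded_linear.has_derivative[OF assms(1)])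
qed

lemma Ck_on_add:
  assumes "Ck_on m f S" "Ck_on m g S"
  shows "Ck_on m (\<lambda>x. f x + g x) S"
  using assms
proof (induction m arbitrary: f g)
  case 0
  then show ?case by (simp add: continuous_on_add)
next
  case (Suc m)
  obtain f' where "\<And>x. x \<in> S \<Longrightarrow> (f has_derivative f' x) (at x within S)"
    and "\<And>h. Ck_on m (\<lambda>x. f' x h) S"
    using Suc.prems(1) by (rule Ck_on_SucE) blast
  moreover obtain g' where "\<And>x. x \<in> S \<Longrightarrow> (g has_derivative g' x) (at x within S)"
    and "\<And>h. Ck_on m (\<lambda>x. g' x h) S"
    using Suc.prems(2) by (rule Ck_on_SucE) blast
  ultimately show ?case
    by (intro Ck_on_SucI[of _ _ "\<lambda>x h. f' x h + g' x h"])
      (auto intro: has_derivative_add Suc.IH)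
qed

text \<open>Both terms of the product rule are again values of \<open>B\<close> on pairs of one
  order less, so the induction closes. Products, scalar multiples and inner products are all
  instances.\<close>

lemma Ck_on_bounded_bilinear:
  assumes "bounded_bilinear B" "Ck_on m f S" "Ck_on m g S"
  shows "Ck_on m (\<lambda>x. B (f x) (g x)) S"
  using assms(2,3)
proof (induction m arbitrary: f g)
  case 0
  then show ?case by (simp add: bounded_bilinear.continuous_on[OF assms(1)])
next
  case (Suc m)
  obtain f' where f': "\<And>x. x \<in> S \<Longrightarrow> (f has_derivative f' x) (at x within S)"
    "\<And>h. Ck_on m (\<lambda>x. f' x h) S"
    using Suc.prems(1) by (rule Ck_on_SucE) blast
  obtain g' where g': "\<And>x. x \<in> S \<Longrightarrow> (g has_derivative g' x) (at x within S)"
    "\<And>h. Ck_on m (\<lambda>x. g' x h) S"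
    using Suc.prems(2) by (rule Ck_on_SucE) blast
  show ?case
  proof (rule Ck_on_SucI[of _ _ "\<lambda>x h. B (f x) (g' x h) + B (f' x h) (g x)"])
    show "((\<lambda>x. B (f x) (g x)) has_derivative (\<lambda>h. B (f x) (g' x h) + B (f' x h) (g x)))
      (at x within S)" if "x \<in> S" for x
      using bounded_bilinear.FDERIV[OF assms(1) f'(1)[OF that] g'(1)[OF that]] .
    show "Ck_on m (\<lambda>x. B (f x) (g' x h) + B (f' x h) (g x)) S" for h
      by (intro Ck_on_add Suc.IH f' g' Suc.prems[THEN Ck_on_SucD])
  qed
qed

lemmas Ck_on_mult = Ck_on_bounded_bilinear[OF bounded_bilinear_mult]
lemmas Ck_on_scaleR = Ck_on_bounded_bilinear[OF bounded_bilinear_scaleR]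
lemmas Ck_on_inner = Ck_on_bounded_bilinear[OF bounded_bilinear_inner]
lemmas Ck_on_uminus = Ck_on_bounded_linear[OF bounded_linear_minus[OF bounded_linear_ident]]
lemmas Ck_on_nth = Ck_on_bounded_linear[OF bounded_linear_vec_nth]

lemma Ck_on_diff: "Ck_on m f S \<Longrightarrow> Ck_on m g S \<Longrightarrow> Ck_on m (\<lambda>x. f x - g x) S"
  using Ck_on_add[OF _ Ck_on_uminus, of m f S g] by simp

lemma Ck_on_sum: "(\<And>i. i \<in> I \<Longrightarrow> Ck_on m (f i) S) \<Longrightarrow> Ck_on m (\<lambda>x. \<Sum>i\<in>I. f i x) S"
  by (induction I rule: infinite_finite_induct) (auto intro: Ck_on_const Ck_on_add)

lemma Ck_on_prod:
  fixes f :: "'i \<Rightarrow> 'a::euclidean_space \<Rightarrow> real"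
  shows "(\<And>i. i \<in> I \<Longrightarrow> Ck_on m (f i) S) \<Longrightarrow> Ck_on m (\<lambda>x. \<Prod>i\<in>I. f i x) S"
  by (induction I rule: infinite_finite_induct) (auto intro: Ck_on_const Ck_on_mult)

lemma Ck_on_vec:
  fixes f :: "'a::euclidean_space \<Rightarrow> real ^ 'n"
  assumes "\<And>i. Ck_on m (\<lambda>x. f x $ i) S"
  shows "Ck_on m f S"
proof -
  have "Ck_on m (\<lambda>x. \<Sum>i\<in>UNIV. (f x $ i) *\<^sub>R (axis i 1 :: real ^ 'n)) S"
    by (intro Ck_on_sum Ck_on_scaleR Ck_on_const assms)
  then show ?thesis
    by (rule Ck_on_cong) (simp add: basis_expansion flip: scalar_mult_eq_scaleR)
qed

text \<open>The Leibniz formula makes the determinant a polynomial in the entries.\<close>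

lemma Ck_on_det:
  fixes A :: "'a::euclidean_space \<Rightarrow> real ^ 'n ^ 'n"
  assumes "\<And>i j. Ck_on m (\<lambda>x. A x $ i $ j) S"
  shows "Ck_on m (\<lambda>x. det (A x)) S"
  unfolding det_def by (intro Ck_on_sum Ck_on_mult Ck_on_prod Ck_on_const assms)

text \<open>Covers \<open>1/t\<close> and \<open>1/\<surd>t\<close> at once: in both cases \<open>g' = c g\<^sup>n\<close>.\<close>

lemma Ck_on_compose_power_ode:
  fixes f :: "'a::euclidean_space \<Rightarrow> real" and g :: "real \<Rightarrow> real"
  assumes "Ck_on m f S" "\<And>x. x \<in> S \<Longrightarrow> (g has_real_derivative c * g (f x) ^ n) (at (f x))"
  shows "Ck_on m (\<lambda>x. g (f x)) S"
  using assms(1)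
proof (induction m)
  case 0
  have "continuous (at x within S) (\<lambda>x. g (f x))" if "x \<in> S" for x
    using 0 that continuous_within_compose3[where g = g and f = f and x = x and s = S]
      DERIV_isCont[OF assms(2)[OF that]]
    by (simp add: continuous_on_eq_continuous_within)
  then show ?case by (simp add: continuous_on_eq_continuous_within)
next
  case (Suc m)
  obtain f' where f': "\<And>x. x \<in> S \<Longrightarrow> (f has_derivative f' x) (at x within S)"
    "\<And>h. Ck_on m (\<lambda>x. f' x h) S"
    using Suc.prems by (rule Ck_on_SucE) blast
  have g: "Ck_on m (\<lambda>x. g (f x)) S"
    by (rule Suc.IH[OF Ck_on_SucD[OF Suc.prems]])
  show ?case
  proof (rule Ck_on_SucI[of _ _ "\<lambda>x h. c * g (f x) ^ n * f' x h"])
    show "((\<lambda>x. g (f x)) has_derivative (\<lambda>h. c * g (f x) ^ n * f' x h)) (at x within S)"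
      if "x \<in> S" for x
      using has_derivative_compose[OF f'(1) assms(2)[unfolded has_field_derivative_def]] that
      by simp
    have "Ck_on m (\<lambda>x. \<Prod>i<n. g (f x)) S"
      by (intro Ck_on_prod g)
    then show "Ck_on m (\<lambda>x. c * g (f x) ^ n * f' x h) S" for h
      by (intro Ck_on_mult Ck_on_const f') simp
  qed
qed

lemma Ck_on_inverse:
  fixes f :: "'a::euclidean_space \<Rightarrow> real"
  assumes "Ck_on m f S" "\<And>x. x \<in> S \<Longrightarrow> f x \<noteq> 0"
  shows "Ck_on m (\<lambda>x. inverse (f x)) S"
  by (rule Ck_on_compose_power_ode[where c = "-1" and n = 2, OF assms(1)])
    (auto intro!: derivative_eq_intros simp: assms power2_eq_square)

lemma Ck_on_divide:
  fixes f g :: "'a::euclidean_space \<Rightarrow> real"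
  assumes "Ck_on m f S" "Ck_on m g S" "\<And>x. x \<in> S \<Longrightarrow> g x \<noteq> 0"
  shows "Ck_on m (\<lambda>x. f x / g x) S"
  unfolding divide_inverse by (intro Ck_on_mult Ck_on_inverse assms)

lemma Ck_on_inverse_norm:
  fixes f :: "'a::euclidean_space \<Rightarrow> 'b::euclidean_space"
  assumes "Ck_on m f S" "\<And>x. x \<in> S \<Longrightarrow> f x \<noteq> 0"
  shows "Ck_on m (\<lambda>x. inverse (norm (f x))) S"
  unfolding norm_eq_sqrt_inner
  \<comment> \<open>The derivative of \<open>t\<close> to the power -1/2 is -1/2 times its cube;
    \<open>f x \<noteq> 0\<close> keeps the argument \<open>f x \<bullet> f x\<close>
    positive.\<close>
  by (rule Ck_on_compose_power_ode[where c = "-1/2" and n = 3 and g = "\<lambda>t. inverse (sqrt t)"])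
    (auto intro!: derivative_eq_intros Ck_on_inner
      simp: assms power3_eq_cube field_simps leD[OF inner_ge_zero])

lemma Ck_on_compose:
  fixes f :: "'a::euclidean_space \<Rightarrow> 'b::euclidean_space"
  assumes "Ck_on m g T" "Ck_on m f S" "f ` S \<subseteq> T"
  shows "Ck_on m (\<lambda>x. g (f x)) S"
  using assms(1,2)
proof (induction m arbitrary: g)
  case 0
  with assms(3) show ?case by (auto intro: continuous_on_compose2)
next
  case (Suc m)
  obtain f' where f': "\<And>x. x \<in> S \<Longrightarrow> (f has_derivative f' x) (at x within S)"
    "\<And>h. Ck_on m (\<lambda>x. f' x h) S"
    using Suc.prems(2) by (rule Ck_on_SucE) blast
  obtain g' where g': "\<And>y. y \<in> T \<Longrightarrow> (g has_derivative g' y) (at y within T)"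
    "\<And>h. Ck_on m (\<lambda>y. g' y h) T"
    using Suc.prems(1) by (rule Ck_on_SucE) blast
  show ?case
  proof (rule Ck_on_SucI[of _ _ "\<lambda>x h. g' (f x) (f' x h)"])
    show "((\<lambda>x. g (f x)) has_derivative (\<lambda>h. g' (f x) (f' x h))) (at x within S)"
      if "x \<in> S" for x
      using that assms(3)
      by (intro has_derivative_in_compose[OF f'(1)] has_derivative_subset[OF g'(1)]) auto
    have "Ck_on m (\<lambda>x. g' (f x) b) S" for b
      by (rule Suc.IH[OF g'(2) Ck_on_SucD[OF Suc.prems(2)]])
    \<comment> \<open>In \<open>g' (f x) (f' x h)\<close> the direction also depends on
      \<open>x\<close>, while the induction covers fixed directions only. Expanding the direction in
      the basis separates the two dependences.\<close>
    then have "Ck_on m (\<lambda>x. \<Sum>b\<in>Basis. (f' x h \<bullet> b) *\<^sub>R g' (f x) b) S" for h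
      by (intro Ck_on_sum Ck_on_scaleR Ck_on_inner Ck_on_const f')
    then show "Ck_on m (\<lambda>x. g' (f x) (f' x h)) S" for h
    proof (rule Ck_on_cong)
      fix x assume "x \<in> S"
      then have "linear (g' (f x))"
        using g'(1) assms(3) has_derivative_linear by blast
      then have "(\<Sum>b\<in>Basis. (f' x h \<bullet> b) *\<^sub>R g' (f x) b)
          = g' (f x) (\<Sum>b\<in>Basis. (f' x h \<bullet> b) *\<^sub>R b)"
        by (simp add: linear_sum linear_scale)
      then show "g' (f x) (f' x h) = (\<Sum>b\<in>Basis. (f' x h \<bullet> b) *\<^sub>R g' (f x) b)"
        by (simp only: euclidean_representation)
    qed
  qed
qed

text \<open>On an open set the derivative is unique, so the existential witness in
  \<open>Ck_on\<close> can be traded for \<open>frechet_derivative\<close>, through which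
  \<open>grad\<close> and \<open>hessian\<close> are defined.\<close>

lemma Ck_on_SucE_open:
  assumes "Ck_on (Suc m) f W" "open W"
  shows "x \<in> W \<Longrightarrow> (f has_derivative frechet_derivative f (at x)) (at x)"
    and "Ck_on m (\<lambda>x. frechet_derivative f (at x) h) W"
proof -
  obtain f' where f': "\<And>x. x \<in> W \<Longrightarrow> (f has_derivative f' x) (at x within W)"
    "\<And>h. Ck_on m (\<lambda>x. f' x h) W"
    using assms(1) by (rule Ck_on_SucE) blast
  have at: "(f has_derivative f' x) (at x)" if "x \<in> W" for x
    using f'(1)[OF that] unfolding at_within_open[OF that assms(2)] .
  have eq: "frechet_derivative f (at x) = f' x" if "x \<in> W" for x
    by (rule frechet_derivative_at[OF at[OF that], symmetric])
  show "x \<in> W \<Longrightarrow> (f has_derivative frechet_derivative f (at x)) (at x)"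
    using at by (simp add: eq)
  show "Ck_on m (\<lambda>x. frechet_derivative f (at x) h) W"
    using f'(2) by (rule Ck_on_cong) (simp add: eq)
qed

lemma Ck_on_grad:
  assumes "Ck_on (Suc m) f W" "open W"
  shows "Ck_on m (grad f) W"
  by (rule Ck_on_vec) (simp add: grad_def Ck_on_SucE_open[OF assms])

lemma Ck_on_hessian:
  assumes "Ck_on (Suc (Suc m)) p W" "open W"
  shows "Ck_on m (\<lambda>x. hessian p x $ i $ j) W"
  unfolding hessian_def matrix_def
  using Ck_on_nth[OF Ck_on_SucE_open(2)[OF Ck_on_grad[OF assms] assms(2)]] by simp

text \<open>
  On \<open>S \<subseteq> \<real>\<close> without isolated points derivatives are unique, so that local derivatives
  fit together.
\<close>

lemma Ck_on_local:
  fixes f :: "real \<Rightarrow> 'b::real_normed_vector"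
  assumes "\<And>x. x \<in> S \<Longrightarrow> at x within S \<noteq> bot"
    and "\<And>x. x \<in> S \<Longrightarrow> \<exists>N. open N \<and> x \<in> N \<and> Ck_on m f (S \<inter> N)"
  shows "Ck_on m f S"
proof -
  have nhd: "at y within S \<inter> N = at y within S" if "open N" "y \<in> N" for y N
    by (rule at_within_nhd[OF that(2,1)]) blast
  show ?thesis
    using assms(2)
  proof (induction m arbitrary: f)
    case 0
    have "continuous (at x within S) f" if x: "x \<in> S" for x
    proof -
      obtain N where N: "open N" "x \<in> N" "Ck_on 0 f (S \<inter> N)"
        using 0 x by blast
      then have "continuous (at x within S \<inter> N) f"
        using x by (simp add: continuous_on_eq_continuous_within)
      then show ?thesis
        by (simp only: nhd[OF N(1,2)])
    qed
    then show ?case by (simp add: continuous_on_eq_continuous_within)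
  next
    case (Suc m)
    \<comment> \<open>The local witnesses need not be related a priori; this single global function
      agrees with each of them by uniqueness of the derivative.\<close>
    define D where "D x = vector_derivative f (at x within S)" for x
    have loc: "\<exists>N. open N \<and> x \<in> N \<and> Ck_on m D (S \<inter> N)"
      "(f has_derivative (\<lambda>h. h *\<^sub>R D x)) (at x within S)" if x: "x \<in> S" for x
    proof -
      obtain N where N: "open N" "x \<in> N" "Ck_on (Suc m) f (S \<inter> N)"
        using Suc.prems x by blast
      obtain f' where f': "\<And>y. y \<in> S \<inter> N \<Longrightarrow> (f has_derivative f' y) (at y within S \<inter> N)"
        "\<And>h. Ck_on m (\<lambda>y. f' y h) (S \<inter> N)"
        using N(3) by (rule Ck_on_SucE) blast
      have D: "(f has_vector_derivative f' y 1) (at y within S)" if "y \<in> S \<inter> N" for y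
      proof -
        have "(f has_derivative f' y) (at y within S)"
          using f'(1)[OF that] that nhd[OF N(1), of y] by simp
        \<comment> \<open>A linear map on the reals is determined by its value at 1.\<close>
        moreover have "(\<lambda>h. h *\<^sub>R f' y 1) = f' y"
        proof
          show "h *\<^sub>R f' y 1 = f' y h" for h
            using linear_scale[OF has_derivative_linear[OF calculation], of h 1] by simp
        qed
        ultimately show ?thesis
          unfolding has_vector_derivative_def by simp
      qed
      have eq: "D y = f' y 1" if "y \<in> S \<inter> N" for y
        unfolding D_def using D[OF that] assms(1) that
        by (intro vector_derivative_within) auto
      have "Ck_on m D (S \<inter> N)"
        using f'(2)[of 1] by (rule Ck_on_cong) (rule eq)
      with N show "\<exists>N. open N \<and> x \<in> N \<and> Ck_on m D (S \<inter> N)" by blast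
      show "(f has_derivative (\<lambda>h. h *\<^sub>R D x)) (at x within S)"
        using D[of x] eq[of x] N x by (simp add: has_vector_derivative_def)
    qed
    have "Ck_on m D S"
      by (rule Suc.IH[OF loc(1)])
    then show ?case
      by (intro Ck_on_SucI[of _ _ "\<lambda>x h. h *\<^sub>R D x"] loc(2) Ck_on_scaleR Ck_on_const)
  qed
qed

subsection \<open>Smoothness of a simple top eigenvalue\<close>

text \<open>As many orthonormal vectors as the dimension are independent, hence span the space; the
  remainder of the expansion is orthogonal to all of them and so to itself.\<close>

lemma orthonormal_family_expand:
  fixes e :: "'i \<Rightarrow> real ^ 'n"
  assumes "card I = CARD('n)"
    and "\<And>i j. i \<in> I \<Longrightarrow> j \<in> I \<Longrightarrow> e i \<bullet> e j = (if i = j then 1 else 0)"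
  shows "y = (\<Sum>i\<in>I. (e i \<bullet> y) *\<^sub>R e i)"
proof -
  have fin: "finite I"
    using assms(1) by (metis card.infinite zero_less_card_finite less_irrefl)
  have inj: "inj_on e I"
    by (rule inj_onI) (metis assms(2) zero_neq_one)
  have indep: "independent (e ` I)"
    by (rule pairwise_orthogonal_independent)
      (use assms(2) in \<open>force simp: pairwise_def orthogonal_def\<close>)+
  have "UNIV \<subseteq> span (e ` I)"
    by (rule card_ge_dim_independent[OF _ indep]) (simp_all add: card_image[OF inj] assms(1))
  moreover have "orthogonal (y - (\<Sum>i\<in>I. (e i \<bullet> y) *\<^sub>R e i)) (e j)" if "j \<in> I" for j
  proof -
    have "(\<Sum>i\<in>I. (e i \<bullet> y) *\<^sub>R e i) \<bullet> e j = (\<Sum>i\<in>I. if i = j then e i \<bullet> y else 0)"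
      unfolding inner_sum_left using assms(2) that by (intro sum.cong) auto
    also have "\<dots> = y \<bullet> e j"
      using fin that by (simp add: inner_commute)
    finally show ?thesis
      by (simp add: orthogonal_def inner_diff_left)
  qed
  ultimately have "orthogonal (y - (\<Sum>i\<in>I. (e i \<bullet> y) *\<^sub>R e i)) z" for z
    by (intro orthogonal_to_span[of z "e ` I"]) auto
  then show ?thesis
    by (metis orthogonal_self right_minus_eq)
qed

text \<open>Lets two such spans be compared through their first vectors alone, as the frame
  condition in \<open>local_frame\<close> requires.\<close>

lemma span_orthonormal_tail:
  fixes e :: "nat \<Rightarrow> real ^ 'n"
  assumes "\<And>i j. i \<in> {1..CARD('n)} \<Longrightarrow> j \<in> {1..CARD('n)} \<Longrightarrow>
    e i \<bullet> e j = (if i = j then 1 else 0)"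
  shows "span (e ` {2..CARD('n)}) = {y. e 1 \<bullet> y = 0}"
proof (intro equalityI subsetI CollectI)
  fix y assume "y \<in> span (e ` {2..CARD('n)})"
  then have "orthogonal (e 1) y"
    by (rule orthogonal_to_span) (use assms in \<open>force simp: orthogonal_def\<close>)
  then show "e 1 \<bullet> y = 0"
    by (simp add: orthogonal_def)
next
  fix y assume "y \<in> {y. e 1 \<bullet> y = 0}"
  moreover have "{1..CARD('n)} = insert 1 {2..CARD('n)}"
    using zero_less_card_finite[where 'a = 'n] by auto
  ultimately have "(\<Sum>i\<in>{1..CARD('n)}. (e i \<bullet> y) *\<^sub>R e i)
      = (\<Sum>i\<in>{2..CARD('n)}. (e i \<bullet> y) *\<^sub>R e i)"
    by simp
  also have "\<dots> \<in> span (e ` {2..CARD('n)})"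
    by (intro span_sum span_scale span_base imageI)
  finally show "y \<in> span (e ` {2..CARD('n)})"
    by (subst orthonormal_family_expand[of "{1..CARD('n)}" e]) (simp_all only: assms, simp)
qed

section \<open>Bilinear forms of matrices and a product rule for a merely continuous factor\<close>

lemma inner_matrix_vector: "x \<bullet> (A *v y) = (\<Sum>i\<in>UNIV. \<Sum>j\<in>UNIV. A $ i $ j * (x $ i * y $ j))"
  for A :: "real ^ 'n ^ 'm"
  by (simp add: inner_vec_def matrix_vector_mult_def sum_distrib_left mult_ac)

lemma abs_inner_matrix_vector_le:
  fixes A :: "real ^ 'n ^ 'm"
  assumes "norm x = 1" "norm y = 1"
  shows "\<bar>x \<bullet> (A *v y)\<bar> \<le> (\<Sum>i\<in>UNIV. \<Sum>j\<in>UNIV. \<bar>A $ i $ j\<bar>)"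
  unfolding inner_matrix_vector
proof (intro sum_abs[THEN order_trans] sum_mono)
  fix i j
  have "\<bar>x $ i\<bar> * \<bar>y $ j\<bar> \<le> 1 * 1"
    using component_le_norm_cart[of x i] component_le_norm_cart[of y j] assms
    by (intro mult_mono) auto
  then show "\<bar>A $ i $ j * (x $ i * y $ j)\<bar> \<le> \<bar>A $ i $ j\<bar>"
    by (simp add: abs_mult mult_left_le)
qed

text \<open>The term containing the derivative of \<open>g\<close> would carry the factor
  \<open>f x = 0\<close>, so continuity of \<open>g\<close> suffices. This is what lets the
  eigenvalue gain a derivative over the eigenvector.\<close>

lemma has_derivative_mult_vanishing:
  fixes f g :: "'a::real_normed_vector \<Rightarrow> real"
  assumes "(f has_derivative f') (at x within S)" "f x = 0" "continuous (at x within S) g"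
  shows "((\<lambda>z. f z * g z) has_derivative (\<lambda>h. f' h * g x)) (at x within S)"
  unfolding has_derivative_within
proof
  have f': "bounded_linear f'"
    and lim: "((\<lambda>z. (1 / norm (z - x)) *\<^sub>R (f z - (f x + f' (z - x)))) \<longlongrightarrow> 0) (at x within S)"
    using assms(1) by (auto simp: has_derivative_within)
  show "bounded_linear (\<lambda>h. f' h * g x)"
    using f' by (rule bounded_linear_mult_left[THEN bounded_linear_compose])
  have g: "(g \<longlongrightarrow> g x) (at x within S)"
    using assms(3) by (simp add: continuous_within)
  have "((\<lambda>z. onorm f' * \<bar>g z - g x\<bar>) \<longlongrightarrow> onorm f' * \<bar>g x - g x\<bar>) (at x within S)"
    by (intro tendsto_intros g)
  then have "((\<lambda>z. onorm f' * \<bar>g z - g x\<bar>) \<longlongrightarrow> 0) (at x within S)"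
    by simp
  \<comment> \<open>The error of the product splits into the remainder of \<open>f\<close> times
    \<open>g\<close> and this term, a bounded quotient times \<open>g z - g x\<close>.\<close>
  then have rest: "((\<lambda>z. f' (z - x) / norm (z - x) * (g z - g x)) \<longlongrightarrow> 0) (at x within S)"
  proof (rule Lim_null_comparison[rotated], intro always_eventually allI)
    fix z
    have "\<bar>f' (z - x)\<bar> / norm (z - x) \<le> onorm f'"
      using onorm[OF f', of "z - x"] onorm_pos_le[OF f'] by (cases "z = x") (simp_all add: field_simps)
    from mult_right_mono[OF this abs_ge_zero]
    show "norm (f' (z - x) / norm (z - x) * (g z - g x)) \<le> onorm f' * \<bar>g z - g x\<bar>"
      by (simp add: abs_mult)
  qed
  have "((\<lambda>z. (1 / norm (z - x)) *\<^sub>R (f z - (f x + f' (z - x))) * g z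
      + f' (z - x) / norm (z - x) * (g z - g x)) \<longlongrightarrow> 0) (at x within S)"
    using tendsto_add[OF tendsto_mult[OF lim g] rest] by simp
  then show "((\<lambda>z. (1 / norm (z - x)) *\<^sub>R (f z * g z - (f x * g x + f' (z - x) * g x))) \<longlongrightarrow> 0)
      (at x within S)"
    by (simp add: assms(2) divide_inverse algebra_simps)
qed

lemma one_index: "1 \<in> {1..CARD('n::finite)}"
  using zero_less_card_finite[where 'a = 'n] by (simp add: Suc_le_eq)

section \<open>Spectral theory of the top eigenvalue\<close>

context
  fixes H :: "real ^ 'n \<Rightarrow> real ^ 'n ^ 'n" and lam v
  assumes eigen: "ordered_eigensystem H lam v"
begin

declare One_nat_def [simp del]

lemma eigen_eq: "i \<in> {1..CARD('n)} \<Longrightarrow> H x *v v i x = lam i x *\<^sub>R v i x"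
  and eigen_ortho: "i \<in> {1..CARD('n)} \<Longrightarrow> j \<in> {1..CARD('n)} \<Longrightarrow>
    v i x \<bullet> v j x = (if i = j then 1 else 0)"
  and eigen_mono: "i \<in> {1..CARD('n)} \<Longrightarrow> j \<in> {1..CARD('n)} \<Longrightarrow> i \<le> j \<Longrightarrow> lam j x \<le> lam i x"
  using eigen unfolding ordered_eigensystem_def by blast+

lemma norm_v: "i \<in> {1..CARD('n)} \<Longrightarrow> norm (v i x) = 1"
  using eigen_ortho by (simp add: norm_eq_1)

lemma eigen_expand: "y = (\<Sum>i\<in>{1..CARD('n)}. (v i x \<bullet> y) *\<^sub>R v i x)"
  by (rule orthonormal_family_expand) (simp_all add: eigen_ortho)

lemma eigen_apply: "H x *v y = (\<Sum>i\<in>{1..CARD('n)}. (lam i x * (v i x \<bullet> y)) *\<^sub>R v i x)"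
proof -
  have "H x *v y = (\<Sum>i\<in>{1..CARD('n)}. H x *v ((v i x \<bullet> y) *\<^sub>R v i x))"
    by (subst eigen_expand[of y x]) (rule linear_sum[OF matrix_vector_mul_linear])
  also have "\<dots> = (\<Sum>i\<in>{1..CARD('n)}. (lam i x * (v i x \<bullet> y)) *\<^sub>R v i x)"
    by (intro sum.cong refl) (simp add: matrix_vector_mult_scaleR eigen_eq mult.commute)
  finally show ?thesis .
qed

lemma inner_eigen_apply:
  "z \<bullet> (H x *v y) = (\<Sum>i\<in>{1..CARD('n)}. lam i x * (v i x \<bullet> y) * (v i x \<bullet> z))"
  unfolding eigen_apply inner_sum_right by (simp add: inner_commute)

text \<open>Symmetry comes from the orthonormal eigenbasis, not from equality of mixed partial
  derivatives.\<close>

lemma eigen_symmetric: "z \<bullet> (H x *v y) = (H x *v z) \<bullet> y"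
  by (simp add: inner_eigen_apply inner_commute[of "H x *v z"] mult_ac)

lemma rayleigh_le: "y \<bullet> (H x *v y) \<le> lam 1 x * (y \<bullet> y)"
proof -
  have "y \<bullet> y = y \<bullet> (\<Sum>i\<in>{1..CARD('n)}. (v i x \<bullet> y) *\<^sub>R v i x)"
    by (rule arg_cong[OF eigen_expand])
  also have "\<dots> = (\<Sum>i\<in>{1..CARD('n)}. (v i x \<bullet> y)\<^sup>2)"
    unfolding inner_sum_right by (simp add: inner_commute power2_eq_square)
  finally have "lam 1 x * (y \<bullet> y) = (\<Sum>i\<in>{1..CARD('n)}. lam 1 x * (v i x \<bullet> y)\<^sup>2)"
    by (simp add: sum_distrib_left)
  also have "\<dots> \<ge> (\<Sum>i\<in>{1..CARD('n)}. lam i x * (v i x \<bullet> y)\<^sup>2)"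
    by (intro sum_mono mult_right_mono eigen_mono one_index) auto
  finally show ?thesis
    by (simp add: inner_eigen_apply power2_eq_square mult.assoc)
qed

text \<open>Testing the Rayleigh bound for \<open>H x\<close> with the top eigenvector of
  \<open>H z\<close> bounds the difference on one side; exchanging \<open>x\<close> and
  \<open>z\<close> gives the other.\<close>

lemma lam_lipschitz:
  "\<bar>lam 1 z - lam 1 x\<bar> \<le> (\<Sum>i\<in>UNIV. \<Sum>j\<in>UNIV. \<bar>H z $ i $ j - H x $ i $ j\<bar>)"
proof -
  have *: "lam 1 z - lam 1 x \<le> (\<Sum>i\<in>UNIV. \<Sum>j\<in>UNIV. \<bar>H z $ i $ j - H x $ i $ j\<bar>)" for x z
  proof -
    have n: "norm (v 1 z) = 1"
      by (rule norm_v[OF one_index])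
    have "lam 1 z = v 1 z \<bullet> (H z *v v 1 z)"
      using n by (simp only: eigen_eq[OF one_index]) (simp add: norm_eq_1)
    also have "\<dots> = v 1 z \<bullet> ((H z - H x) *v v 1 z) + v 1 z \<bullet> (H x *v v 1 z)"
      by (simp add: matrix_vector_mult_diff_rdistrib inner_diff_right)
    also have "\<dots> \<le> (\<Sum>i\<in>UNIV. \<Sum>j\<in>UNIV. \<bar>(H z - H x) $ i $ j\<bar>) + lam 1 x"
      using abs_inner_matrix_vector_le[OF n n, of "H z - H x"] rayleigh_le[of "v 1 z" x] n
      by (simp add: norm_eq_1)
    finally show ?thesis by simp
  qed
  have "(\<Sum>i\<in>UNIV. \<Sum>j\<in>UNIV. \<bar>H x $ i $ j - H z $ i $ j\<bar>)
      = (\<Sum>i\<in>UNIV. \<Sum>j\<in>UNIV. \<bar>H z $ i $ j - H x $ i $ j\<bar>)"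
    by (intro sum.cong refl abs_minus_commute)
  with *[of z x] *[of x z] show ?thesis
    by (simp only: abs_le_iff minus_diff_eq simp_thms)
qed

lemma continuous_lam:
  assumes "\<And>i j. continuous_on W (\<lambda>x. H x $ i $ j)"
  shows "continuous_on W (lam 1)"
  unfolding continuous_on_def
proof (intro ballI, rule LIM_zero_cancel)
  fix x assume x: "x \<in> W"
  have lim: "((\<lambda>z. H z $ i $ j) \<longlongrightarrow> H x $ i $ j) (at x within W)" for i j
    using assms[of i j] x by (simp add: continuous_on_def)
  have "((\<lambda>z. \<Sum>i\<in>UNIV. \<Sum>j\<in>UNIV. \<bar>H z $ i $ j - H x $ i $ j\<bar>) \<longlongrightarrow>
     (\<Sum>i\<in>UNIV. \<Sum>j\<in>UNIV. \<bar>H x $ i $ j - H x $ i $ j\<bar>)) (at x within W)"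
    by (intro tendsto_sum tendsto_rabs tendsto_diff tendsto_const lim)
  then have "((\<lambda>z. \<Sum>i\<in>UNIV. \<Sum>j\<in>UNIV. \<bar>H z $ i $ j - H x $ i $ j\<bar>) \<longlongrightarrow> 0) (at x within W)"
    by simp
  then show "((\<lambda>z. lam 1 z - lam 1 x) \<longlongrightarrow> 0) (at x within W)"
    by (rule Lim_null_comparison[rotated]) (simp add: lam_lipschitz)
qed

text \<open>Symmetry moves \<open>H x\<close> onto \<open>a\<close>. The identity is exact, so
  dividing by \<open>a \<bullet> b\<close> expresses the increment of the eigenvalue without an
  error term.\<close>

lemma eigenvalue_difference:
  assumes "H x *v a = lam 1 x *\<^sub>R a" "H z *v b = lam 1 z *\<^sub>R b"
  shows "(lam 1 z - lam 1 x) * (a \<bullet> b) = a \<bullet> ((H z - H x) *v b)"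
  using eigen_symmetric[where z = a and x = x and y = b] assms
  by (simp add: matrix_vector_mult_diff_rdistrib inner_diff_right algebra_simps)

text \<open>
  The Hellmann--Feynman formula. It needs \<open>w\<close> to be merely continuous, so it gains a derivative in
  the bootstrap below.
\<close>

lemma has_derivative_top_eigenvalue:
  assumes "open W" "x \<in> W" "continuous_on W w"
    and w: "\<And>z. z \<in> W \<Longrightarrow> H z *v w z = lam 1 z *\<^sub>R w z" "w x \<noteq> 0"
    and H': "\<And>i j. ((\<lambda>z. H z $ i $ j) has_derivative H' i j) (at x)"
  shows "(lam 1 has_derivative
      (\<lambda>h. \<Sum>i\<in>UNIV. \<Sum>j\<in>UNIV. H' i j h * (w x $ i * w x $ j / (w x \<bullet> w x)))) (at x)"
proof -
  \<comment> \<open>These weights come from \<open>eigenvalue_difference\<close> with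
    \<open>a = w x\<close> and \<open>b = w z\<close>; they multiply entries of
    \<open>H z - H x\<close>, which vanish at \<open>z = x\<close>.\<close>
  define g where "g i j z = w x $ i * w z $ j / (w x \<bullet> w z)" for i j z
  have cw: "isCont w x"
    using assms(1-3) continuous_on_eq_continuous_at by blast
  have "((\<lambda>z. (H z $ i $ j - H x $ i $ j) * g i j z) has_derivative (\<lambda>h. H' i j h * g i j x)) (at x)"
    for i j
  proof (rule has_derivative_mult_vanishing)
    show "((\<lambda>z. H z $ i $ j - H x $ i $ j) has_derivative H' i j) (at x)"
      using has_derivative_diff[OF H' has_derivative_const] by simp
    show "isCont (g i j) x"
      unfolding g_def using w(2) by (intro continuous_intros cw) simp
  qed simp
  then have "((\<lambda>z. lam 1 x + (\<Sum>i\<in>UNIV. \<Sum>j\<in>UNIV. (H z $ i $ j - H x $ i $ j) * g i j z))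
      has_derivative (\<lambda>h. 0 + (\<Sum>i\<in>UNIV. \<Sum>j\<in>UNIV. H' i j h * g i j x))) (at x)"
    by (intro has_derivative_add has_derivative_sum has_derivative_const)
  then have "(lam 1 has_derivative (\<lambda>h. 0 + (\<Sum>i\<in>UNIV. \<Sum>j\<in>UNIV. H' i j h * g i j x))) (at x)"
  proof (rule has_derivative_transform_eventually)
    have eq: "lam 1 x + (\<Sum>i\<in>UNIV. \<Sum>j\<in>UNIV. (H z $ i $ j - H x $ i $ j) * g i j z) = lam 1 z"
      if "z \<in> W" "w x \<bullet> w z \<noteq> 0" for z
    proof -
      have "(\<Sum>i\<in>UNIV. \<Sum>j\<in>UNIV. (H z $ i $ j - H x $ i $ j) * g i j z)
          = w x \<bullet> ((H z - H x) *v w z) / (w x \<bullet> w z)"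
        by (simp add: g_def inner_matrix_vector sum_divide_distrib)
      also have "\<dots> = lam 1 z - lam 1 x"
        using eigenvalue_difference[OF w(1)[OF assms(2)] w(1)[OF that(1)]] that(2)
        by (simp add: field_simps)
      finally show ?thesis by simp
    qed
    have "((\<lambda>z. w x \<bullet> w z) \<longlongrightarrow> w x \<bullet> w x) (at x)"
      using cw by (intro tendsto_intros) (simp add: isCont_def)
    then have "\<forall>\<^sub>F z in at x. w x \<bullet> w z \<noteq> 0"
      by (rule tendsto_imp_eventually_ne) (use w(2) in simp)
    moreover have "\<forall>\<^sub>F z in at x. z \<in> W"
      using assms(1,2) by (rule eventually_at_in_open')
    ultimately show "\<forall>\<^sub>F z in at x.
        lam 1 x + (\<Sum>i\<in>UNIV. \<Sum>j\<in>UNIV. (H z $ i $ j - H x $ i $ j) * g i j z) = lam 1 z"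
      by eventually_elim (rule eq)
    show "lam 1 x + (\<Sum>i\<in>UNIV. \<Sum>j\<in>UNIV. (H x $ i $ j - H x $ i $ j) * g i j x) = lam 1 x"
      by simp
  qed simp
  then show ?thesis
    by (simp add: g_def)
qed

text \<open>The given \<open>v 1\<close> is chosen pointwise and may jump in sign, so only the line
  through it is claimed to vary smoothly.\<close>

lemma smooth_top_eigenvector:
  assumes card: "CARD('n) \<ge> 2" and gap: "lam 2 x0 < lam 1 x0"
    and H: "\<And>i j. Ck_on m (\<lambda>x. H x $ i $ j) UNIV"
  obtains W w where "open W" "x0 \<in> W" "Ck_on m w W"
    "\<And>x. x \<in> W \<Longrightarrow> v 1 x0 \<bullet> w x = 1"
    "\<And>x. x \<in> W \<Longrightarrow> v 1 x \<in> span {w x}"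
proof -
  define u0 where "u0 = v 1 x0"
  define M where "M x = (\<chi> i j. H x $ i $ j - lam 1 x * (if i = j then 1 else 0) - u0 $ i * u0 $ j)"
    for x
  define W where "W = {x. det (M x) \<noteq> 0}"
  \<comment> \<open>Cramer's quotient for \<open>M x *v y = - u0\<close>. The right-hand side is the
    value of \<open>M x\<close> at a top eigenvector \<open>y\<close> normalized by
    \<open>u0 \<bullet> y = 1\<close>.\<close>
  define w where
    "w x = (\<chi> k. det (\<chi> i j. if j = k then (- u0) $ i else M x $ i $ j) / det (M x))" for x
  note eq1 = eigen_eq[OF one_index]
  have u0: "u0 \<bullet> u0 = 1"
    using norm_v[OF one_index, where x = x0] by (simp add: u0_def norm_eq_1)
  have M: "M x *v y = H x *v y - lam 1 x *\<^sub>R y - (u0 \<bullet> y) *\<^sub>R u0" for x y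
  proof -
    have "M x = H x - lam 1 x *\<^sub>R mat 1 - (\<chi> i j. u0 $ i * u0 $ j)"
      by (simp add: M_def vec_eq_iff mat_def)
    moreover have "(\<chi> i j. u0 $ i * u0 $ j) *v y = (u0 \<bullet> y) *\<^sub>R u0"
      by (simp add: vec_eq_iff matrix_vector_mult_def inner_vec_def sum_distrib_left
          sum_distrib_right mult_ac)
    ultimately show ?thesis
      by (simp add: matrix_vector_mult_diff_rdistrib flip: scaleR_matrix_vector_assoc)
  qed
  have cont: "continuous_on UNIV (lam 1)"
    by (rule continuous_lam[OF Ck_on_imp_continuous_on[OF H]])
  \<comment> \<open>The order \<open>j\<close> and the set \<open>S\<close> stay free:
    \<open>j = 0\<close> on the whole space makes \<open>W\<close> open, and the bootstrap on
    \<open>W\<close> raises \<open>j\<close>.\<close>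
  have Ck_M: "Ck_on j (\<lambda>x. M x $ a $ b) S" if "j \<le> m" "Ck_on j (lam 1) S" for j a b S
    unfolding M_def vec_lambda_beta
    by (intro Ck_on_diff Ck_on_mult Ck_on_const that Ck_on_subset[OF Ck_on_le[OF that(1) H]]) simp
  have "continuous_on UNIV (\<lambda>x. det (M x))"
    using Ck_on_det[OF Ck_M[of 0 UNIV]] cont by simp
  then have "open W"
    unfolding W_def by (intro open_Collect_neq continuous_on_const)
  \<comment> \<open>Pairing the kernel equation with \<open>u0\<close> leaves only the rank-one
    term, so \<open>u0 \<bullet> y = 0\<close>. Then \<open>y\<close> satisfies the eigenvalue
    equation for \<open>lam 1 x0\<close>, and the gap annihilates its remaining components.\<close>
  have "y = 0" if "M x0 *v y = 0" for y
  proof -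
    have "u0 \<bullet> (H x0 *v y) = lam 1 x0 * (u0 \<bullet> y)"
      unfolding eigen_symmetric u0_def eq1 by simp
    moreover have "u0 \<bullet> (M x0 *v y) = 0"
      using that by simp
    ultimately have perp: "u0 \<bullet> y = 0"
      by (simp add: M inner_diff_right u0)
    have "v i x0 \<bullet> y = 0" if i: "i \<in> {1..CARD('n)}" for i
    proof (cases "i = 1")
      case False
      have "lam i x0 * (v i x0 \<bullet> y) = v i x0 \<bullet> (H x0 *v y)"
        unfolding eigen_symmetric eigen_eq[OF i] by simp
      also have "\<dots> = lam 1 x0 * (v i x0 \<bullet> y)"
        using \<open>M x0 *v y = 0\<close> perp by (simp add: M)
      finally show ?thesis
        using eigen_mono[where i = 2 and j = i and x = x0] i False card gap by auto
    qed (use perp u0_def in simp)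
    then show "y = 0"
      by (subst eigen_expand[where y = y and x = x0]) simp
  qed
  then have "x0 \<in> W"
    unfolding W_def mem_Collect_eq
    by (simp only: invertible_det_nz[symmetric] invertible_left_inverse matrix_left_invertible_ker)
      simp
  have Mw: "M x *v y = - u0 \<longleftrightarrow> y = w x" if "x \<in> W" for x y
    using that unfolding W_def mem_Collect_eq w_def by (rule cramer)
  have inj: "y = 0" if "x \<in> W" "M x *v y = 0" for x y
    using Mw[OF that(1), of "w x"] Mw[OF that(1), of "w x + y"] that(2)
    by (simp add: matrix_vector_right_distrib)
  \<comment> \<open>Both \<open>v 1 x\<close> and \<open>(u0 \<bullet> v 1 x)\<close> times
    \<open>w x\<close> are mapped by \<open>M x\<close> to the same multiple of \<open>u0\<close>,
    and \<open>M x\<close> is injective.\<close>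
  have v1: "v 1 x = (u0 \<bullet> v 1 x) *\<^sub>R w x" if "x \<in> W" for x
  proof -
    have "M x *v (v 1 x - (u0 \<bullet> v 1 x) *\<^sub>R w x) = 0"
      using Mw[OF that, of "w x"]
      by (simp add: matrix_vector_mult_diff_distrib matrix_vector_mult_scaleR)
        (simp only: M eq1, simp)
    then show ?thesis
      using inj[OF that] by fastforce
  qed
  have nz: "u0 \<bullet> v 1 x \<noteq> 0" if "x \<in> W" for x
    using v1[OF that] norm_v[OF one_index, where x = x] by force
  have w1: "u0 \<bullet> w x = 1" if "x \<in> W" for x
    using arg_cong[OF v1[OF that], of "(\<bullet>) u0"] nz[OF that] by simp
  have eig_w: "H x *v w x = lam 1 x *\<^sub>R w x" if "x \<in> W" for x
    using Mw[OF that, of "w x"] by (simp add: M w1[OF that])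
  have Ck_w: "Ck_on j w W" if "j \<le> m" "Ck_on j (lam 1) W" for j
    unfolding w_def
  proof (intro Ck_on_vec, unfold vec_lambda_beta, intro Ck_on_divide Ck_on_det)
    show "Ck_on j (\<lambda>x. (\<chi> a b. if b = k then (- u0) $ a else M x $ a $ b) $ a $ b) W" for k a b
      by (cases "b = k") (simp_all add: Ck_on_const Ck_M[OF that])
  qed (use Ck_M[OF that] in \<open>auto simp: W_def\<close>)
  have "Ck_on j (lam 1) W" if "j \<le> m" for j
    using that
  proof (induction j)
    case 0
    then show ?case
      using continuous_on_subset[OF cont] by simp
  next
    case (Suc j)
    \<comment> \<open>Since \<open>Suc j \<le> m\<close>, one derivative of \<open>H\<close> may be
      spent: it is of class \<open>C^n\<close> with \<open>j \<le> n\<close>.\<close>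
    then obtain n where n: "m = Suc n" "j \<le> n"
      by (cases m) auto
    have wj: "Ck_on j w W"
      using Suc by (intro Ck_w) auto
    define H' where "H' a b x = frechet_derivative (\<lambda>x. H x $ a $ b) (at x)" for a b x
    have H': "((\<lambda>x. H x $ a $ b) has_derivative H' a b x) (at x)"
      "Ck_on j (\<lambda>x. H' a b x h) W" for a b x h
      unfolding H'_def using Ck_on_SucE_open[OF H[unfolded n(1)] open_UNIV]
      by (blast intro: Ck_on_le[OF n(2)] Ck_on_subset)+
    show ?case
    proof (rule Ck_on_SucI)
      show "(lam 1 has_derivative (\<lambda>h. \<Sum>a\<in>UNIV. \<Sum>b\<in>UNIV.
          H' a b x h * (w x $ a * w x $ b / (w x \<bullet> w x)))) (at x within W)" if "x \<in> W" for x
        using has_derivative_top_eigenvalue[OF \<open>open W\<close> that Ck_on_imp_continuous_on[OF wj] eig_w _ H'(1)]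
          w1[OF that] has_derivative_at_withinI by fastforce
      show "Ck_on j (\<lambda>x. \<Sum>a\<in>UNIV. \<Sum>b\<in>UNIV. H' a b x h * (w x $ a * w x $ b / (w x \<bullet> w x))) W" for h
        using w1 by (intro Ck_on_sum Ck_on_mult Ck_on_divide Ck_on_inner Ck_on_nth H' wj) force
    qed
  qed
  then have "Ck_on m w W"
    by (intro Ck_w) auto
  moreover have "v 1 x \<in> span {w x}" if "x \<in> W" for x
    by (subst v1[OF that]) (simp add: span_base span_scale)
  ultimately show thesis
    using that \<open>open W\<close> \<open>x0 \<in> W\<close> w1 unfolding u0_def by blast
qed

end

subsection \<open>The ridge curve\<close>

text \<open>
  The vector \<open>a - (a \<bullet> u / (1 + u0 \<bullet> u)) (u0 + u)\<close> is the image of \<open>a\<close> (with \<open>u0 \<bullet> a = 0\<close>) under the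
  reflection in the hyperplane orthogonal to \<open>u0 + u\<close>, which sends \<open>u0\<close> to \<open>-u\<close>.
\<close>

lemma reflect_inner:
  fixes a b u u0 :: "'a::real_inner"
  assumes "u \<bullet> u = 1" "u0 \<bullet> u0 = 1" "1 + u0 \<bullet> u \<noteq> 0" "u0 \<bullet> a = 0"
  shows "(a - (a \<bullet> u / (1 + u0 \<bullet> u)) *\<^sub>R (u0 + u)) \<bullet> u = 0"
    and "u0 \<bullet> b = 0 \<Longrightarrow> (a - (a \<bullet> u / (1 + u0 \<bullet> u)) *\<^sub>R (u0 + u)) \<bullet>
      (b - (b \<bullet> u / (1 + u0 \<bullet> u)) *\<^sub>R (u0 + u)) = a \<bullet> b"
proof -
  define c where "c = 1 + u0 \<bullet> u"
  define \<alpha> \<beta> where "\<alpha> = a \<bullet> u" and "\<beta> = b \<bullet> u"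
  have c: "c \<noteq> 0" "(u0 + u) \<bullet> u = c" "(u0 + u) \<bullet> (u0 + u) = 2 * c"
    using assms by (simp_all add: c_def inner_add_left inner_add_right inner_commute[of u u0])
  then show "(a - (a \<bullet> u / (1 + u0 \<bullet> u)) *\<^sub>R (u0 + u)) \<bullet> u = 0"
    by (simp add: inner_diff_left flip: c_def)
  assume b: "u0 \<bullet> b = 0"
  have ab: "a \<bullet> (u0 + u) = \<alpha>" "(u0 + u) \<bullet> b = \<beta>"
    using assms(4) b by (simp_all add: inner_add_left inner_add_right inner_commute \<alpha>_def \<beta>_def)
  have "(a - (\<alpha> / c) *\<^sub>R (u0 + u)) \<bullet> (b - (\<beta> / c) *\<^sub>R (u0 + u))
      = a \<bullet> b - \<beta> / c * (a \<bullet> (u0 + u)) - \<alpha> / c * ((u0 + u) \<bullet> b)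
        + \<alpha> / c * (\<beta> / c * ((u0 + u) \<bullet> (u0 + u)))"
    by (simp only: inner_diff_left inner_diff_right inner_scaleR_left inner_scaleR_right)
      (simp only: right_diff_distrib, simp)
  also have "\<dots> = a \<bullet> b"
    unfolding ab c(3) using c(1) by (simp add: field_simps)
  finally show "(a - (a \<bullet> u / (1 + u0 \<bullet> u)) *\<^sub>R (u0 + u)) \<bullet>
      (b - (b \<bullet> u / (1 + u0 \<bullet> u)) *\<^sub>R (u0 + u)) = a \<bullet> b"
    by (simp only: c_def \<alpha>_def \<beta>_def)
qed

lemma local_frame_exists:
  fixes H :: "real ^ 'n \<Rightarrow> real ^ 'n ^ 'n"
  assumes eigen: "ordered_eigensystem H lam v"
    and card: "CARD('n) \<ge> 2" and gap: "lam 2 x0 < lam 1 x0"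
    and H: "\<And>i j. Ck_on m (\<lambda>x. H x $ i $ j) UNIV"
  obtains W E where "x0 \<in> W" "local_frame m v W E"
proof -
  obtain W w where W: "open W" "x0 \<in> W" and Ck_w: "Ck_on m w W"
    and w1: "\<And>x. x \<in> W \<Longrightarrow> v 1 x0 \<bullet> w x = 1"
    and v1: "\<And>x. x \<in> W \<Longrightarrow> v 1 x \<in> span {w x}"
    using smooth_top_eigenvector[OF assms] by blast
  define u where "u x = inverse (norm (w x)) *\<^sub>R w x" for x
  \<comment> \<open>Only eigenvectors at the base point \<open>x0\<close> enter; all dependence on
    \<open>x\<close> is through the smooth field \<open>u\<close>.\<close>
  define E where
    "E i x = v i x0 - (v i x0 \<bullet> u x / (1 + v 1 x0 \<bullet> u x)) *\<^sub>R (v 1 x0 + u x)" for i x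
  note ortho = eigen_ortho[OF eigen]
  have w0: "w x \<noteq> 0" if "x \<in> W" for x
    using w1[OF that] by auto
  then have "norm (u x) = 1" if "x \<in> W" for x
    using that by (simp add: u_def)
  then have uu: "u x \<bullet> u x = 1" if "x \<in> W" for x
    using that by (simp add: norm_eq_1)
  \<comment> \<open>\<open>w x\<close> has component 1 along \<open>v 1 x0\<close>, so the component
    of its normalization \<open>u x\<close> is positive and the reflection has no vanishing
    denominator.\<close>
  have pos: "1 + v 1 x0 \<bullet> u x > 0" if "x \<in> W" for x
    using w1[OF that] by (simp add: u_def add_pos_nonneg)
  have Ck_u: "Ck_on m u W"
    unfolding u_def by (intro Ck_on_scaleR Ck_on_inverse_norm Ck_w w0)
  have "Ck_on m (E i) W" for i
    unfolding E_def
    by (intro Ck_on_diff Ck_on_scaleR Ck_on_divide Ck_on_inner Ck_on_add Ck_on_const Ck_u)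
      (use pos in force)
  moreover have E: "E i x \<bullet> u x = 0" "E i x \<bullet> E j x = (if i = j then 1 else 0)"
    if "x \<in> W" "i \<in> {2..CARD('n)}" "j \<in> {2..CARD('n)}" for i j x
    using that ortho[of 1 i x0] ortho[of 1 j x0] ortho[of i j x0] ortho[of 1 1 x0] pos[of x]
      reflect_inner(1)[of "u x" "v 1 x0" "v i x0"]
      reflect_inner(2)[of "u x" "v 1 x0" "v i x0" "v j x0"] uu[of x]
    by (simp_all add: E_def)
  moreover have "span ((\<lambda>i. E i x) ` {2..CARD('n)}) = span ((\<lambda>i. v i x) ` {2..CARD('n)})"
    if x: "x \<in> W" for x
  proof -
    \<comment> \<open>Completing the frame by \<open>u x\<close> yields an orthonormal basis, so
      both spans are orthogonal complements: of \<open>u x\<close> and of \<open>v 1 x\<close>,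
      which lie on the same line.\<close>
    define e where "e i = (if i = 1 then u x else E i x)" for i
    have "(\<lambda>i. E i x) ` {2..CARD('n)} = e ` {2..CARD('n)}"
      by (intro image_cong) (auto simp: e_def)
    moreover have "span (e ` {2..CARD('n)}) = {y. e 1 \<bullet> y = 0}"
    proof (rule span_orthonormal_tail)
      show "e i \<bullet> e j = (if i = j then 1 else 0)"
        if "i \<in> {1..CARD('n)}" "j \<in> {1..CARD('n)}" for i j
      proof -
        have cases: "l = 1 \<or> l \<in> {2..CARD('n)}" if "l \<in> {1..CARD('n)}" for l
          using that by auto
        have "u x \<bullet> E l x = 0" if "l \<in> {2..CARD('n)}" for l
          using E(1)[OF x that that] by (simp add: inner_commute)
        then show ?thesis
          using cases[OF that(1)] cases[OF that(2)] E[OF x] uu[OF x] by (auto simp: e_def)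
      qed
    qed
    moreover have "span ((\<lambda>i. v i x) ` {2..CARD('n)}) = {y. v 1 x \<bullet> y = 0}"
      by (rule span_orthonormal_tail) (rule ortho)
    moreover have "u x \<bullet> y = 0 \<longleftrightarrow> v 1 x \<bullet> y = 0" for y
    proof -
      obtain c where c: "v 1 x = c *\<^sub>R w x"
        using v1[OF x] by (auto simp: span_singleton)
      then have "c \<noteq> 0"
        using norm_v[OF eigen one_index, of x] by force
      with c w0[OF x] show ?thesis
        by (simp add: u_def)
    qed
    ultimately show ?thesis
      by (simp add: e_def)
  qed
  ultimately have "local_frame m v W E"
    unfolding local_frame_def using W(1) by blast
  with W(2) show thesis
    by (rule that)
qed

section \<open>Smoothness of the tangent field and of its integral curves\<close>

lemma Ck_on_gen_cross:
  fixes r :: "nat \<Rightarrow> 'a::euclidean_space \<Rightarrow> real ^ 'n"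
  assumes "\<And>i. i \<in> {2..CARD('n)} \<Longrightarrow> Ck_on m (r i) W"
  shows "Ck_on m (\<lambda>x. gen_cross (\<lambda>i. r i x)) W"
proof (rule Ck_on_vec)
  fix j :: 'n
  have "Ck_on m (\<lambda>x. (let i = Suc (to_nat_on (UNIV :: 'n set) a)
    in if i = 1 then axis j 1 else r i x) $ b) W" for a b :: 'n
  proof (cases "to_nat_on (UNIV :: 'n set) a = 0")
    case False
    \<comment> \<open>The enumeration starts at 0, so a nonzero value below \<open>d\<close> has its
      successor in \<open>{2..d}\<close>, where \<open>r\<close> is assumed smooth.\<close>
    have "to_nat_on (UNIV :: 'n set) a < CARD('n)"
      using bij_betwE[OF to_nat_on_finite[of "UNIV :: 'n set"]] by auto
    with False assms[of "Suc (to_nat_on (UNIV :: 'n set) a)"] show ?thesis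
      by (auto intro: Ck_on_nth)
  qed (simp add: Ck_on_const)
  then show "Ck_on m (\<lambda>x. gen_cross (\<lambda>i. r i x) $ j) W"
    unfolding gen_cross_def vec_lambda_beta by (intro Ck_on_det) simp
qed

lemma Ck_on_ridge_fun:
  fixes p :: "real ^ 'n \<Rightarrow> real"
  assumes "local_frame m v W E" "Ck_on (Suc m) p UNIV" "i \<in> {2..CARD('n)}"
  shows "Ck_on m (ridge_fun p E i) W"
proof -
  have "Ck_on m (E i) W"
    using assms(1,3) unfolding local_frame_def by blast
  moreover have "Ck_on m (grad p) W"
    using Ck_on_grad[OF assms(2) open_UNIV] by (rule Ck_on_subset) simp
  ultimately show ?thesis
    unfolding ridge_fun_def by (rule Ck_on_inner)
qed

text \<open>The Jacobian of \<open>F\<close> costs one derivative; integrating the traversal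
  equation wins it back.\<close>

lemma Ck_on_ridge_tangent:
  assumes "local_frame (Suc n) v W E" "Ck_on (Suc (Suc n)) p UNIV"
  shows "Ck_on n (ridge_tangent p E) W"
proof -
  have "open W"
    using assms(1) unfolding local_frame_def by blast
  then show ?thesis
    unfolding ridge_tangent_def
    by (intro Ck_on_gen_cross Ck_on_grad Ck_on_ridge_fun[OF assms])
qed

text \<open>Bootstrap: if \<open>\<phi>\<close> is \<open>C^j\<close> with \<open>j \<le> n\<close>,
  then so is its derivative, the composition of \<open>T\<close> with \<open>\<phi>\<close>, and
  \<open>\<phi>\<close> is one order smoother.\<close>

lemma Ck_on_autonomous_ode:
  fixes \<phi> :: "real \<Rightarrow> 'a::euclidean_space"
  assumes "Ck_on n T W" "\<phi> ` J \<subseteq> W"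
    and "\<And>t. t \<in> J \<Longrightarrow> (\<phi> has_vector_derivative T (\<phi> t)) (at t within J)"
  shows "Ck_on (Suc n) \<phi> J"
proof -
  have "Ck_on j \<phi> J" if "j \<le> Suc n" for j
    using that
  proof (induction j)
    case 0
    show ?case
      using has_vector_derivative_continuous[OF assms(3)]
      by (simp add: continuous_on_eq_continuous_within)
  next
    case (Suc j)
    have "Ck_on j (\<lambda>t. T (\<phi> t)) J"
      by (rule Ck_on_compose[OF Ck_on_le[OF _ assms(1)] Suc.IH assms(2)]) (use Suc.prems in simp_all)
    then have "Ck_on j (\<lambda>t. h *\<^sub>R T (\<phi> t)) J" for h
      by (intro Ck_on_scaleR Ck_on_const)
    then show ?case
      using assms(3) unfolding has_vector_derivative_def by (intro Ck_on_SucI)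
  qed
  then show ?thesis by blast
qed

theorem theorem1:
  fixes p :: "real ^ 'n \<Rightarrow> real"
    and lam :: "nat \<Rightarrow> real ^ 'n \<Rightarrow> real"
    and v :: "nat \<Rightarrow> real ^ 'n \<Rightarrow> real ^ 'n"
    and \<phi> :: "real \<Rightarrow> real ^ 'n"
    and R U :: "(real ^ 'n) set"
    and pieces :: "(real ^ 'n) set set"
    and k :: nat and s0 :: real
  assumes "CARD('n) \<ge> 2"
    and "prob_density p"
    and "compact (closure {x. p x \<noteq> 0})"
    and "k \<ge> 2"
    and "Ck_on k p UNIV"
    and "ordered_eigensystem (hessian p) lam v"
    and "finite pieces" and "\<Union>pieces = ridge p lam v"
    and "\<And>M. M \<in> pieces \<Longrightarrow> one_manifold M"
    and "R \<in> pieces"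
    and "ridge_parametrization k p v R \<phi>"
    and "s0 \<in> {0..1}"
    and "openin (top_of_set R) U" and "\<phi> s0 \<in> U"
    and "\<And>x. x \<in> U \<Longrightarrow> eigengap lam x > 0"
  shows "Ck_on (k - 2) \<phi> {s \<in> {0..1}. \<phi> s \<in> U}"
proof -
  define S where "S = {s \<in> {0..1}. \<phi> s \<in> U}"
  obtain c where cont: "continuous_on {0..1} \<phi>" and im: "\<phi> ` {0..1} = R"
    and trav: "traverses k p v c \<phi>"
    using assms(11) by (auto simp: ridge_parametrization_def path_def path_image_def)
  have "Ck_on (k - 2) \<phi> S"
  \<comment> \<open>For \<open>k = 2\<close> only continuity is claimed, and \<open>\<phi>\<close>
    is a path. From \<open>k = 3\<close> on, \<open>F\<close> is \<open>C^1\<close> in a suitable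
    frame and the traversal equation is available.\<close>
  proof (cases "k - 2")
    case 0
    then show ?thesis
      using cont by (auto simp: S_def intro: continuous_on_subset)
  next
    case (Suc n)
    then have k: "k = Suc (Suc (Suc n))"
      by simp
    have p: "Ck_on (Suc (Suc (Suc n))) p UNIV"
      using assms(5) by (simp only: k)
    have preim: "\<exists>A. open A \<and> {0..1} \<inter> \<phi> -` O' = {0..1} \<inter> A" if "open O'" for O'
      using continuous_openin_preimage_gen[OF cont that] by (auto simp: openin_open)
    \<comment> \<open>\<open>S\<close> is relatively open in the unit interval, so limits within
      \<open>S\<close> agree with limits within \<open>{0..1}\<close> and \<open>S\<close> has no
      isolated points.\<close>
    obtain A where A: "open A" "S = {0..1} \<inter> A"
    proof -
      obtain O' where "open O'" "U = R \<inter> O'"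
        using assms(13) by (auto simp: openin_open)
      moreover from this have "S = {0..1} \<inter> \<phi> -` O'"
        using im by (auto simp: S_def)
      ultimately show thesis
        using preim that by metis
    qed
    show ?thesis
    proof (rule Ck_on_local)
      fix s assume s: "s \<in> S"
      have "at s within S = at s within {0..1}"
        by (rule at_within_nhd[of s A]) (use s A in auto)
      moreover have "s islimpt {0..1}"
        using s by (simp add: S_def)
      ultimately show "at s within S \<noteq> bot"
        by (simp add: trivial_limit_within)
      have "lam 2 (\<phi> s) < lam 1 (\<phi> s)"
        using assms(15)[of "\<phi> s"] s by (simp add: S_def eigengap_def)
      then obtain W E where W: "\<phi> s \<in> W" and frame: "local_frame (Suc n) v W E"
        using local_frame_exists[OF assms(6,1)] Ck_on_hessian[OF p open_UNIV] by blast
      have "Ck_on 1 (ridge_fun p E i) W" if "i \<in> {2..CARD('n)}" for i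
        by (rule Ck_on_le[OF _ Ck_on_ridge_fun[OF frame Ck_on_SucD[OF p] that]]) simp
      then have "\<phi> s \<in> W \<and> local_frame (k - 2) v W E
          \<and> (\<forall>i\<in>{2..CARD('n)}. Ck_on 1 (ridge_fun p E i) W)"
        using W frame Suc by simp
      moreover have "s \<in> {0..1}"
        using s by (simp add: S_def)
      ultimately have "\<exists>\<sigma>\<in>{-1, 1}. \<exists>\<delta>>0. \<forall>t\<in>{0..1}. \<bar>t - s\<bar> < \<delta> \<longrightarrow>
          (\<phi> has_vector_derivative (c * \<sigma>) *\<^sub>R ridge_tangent p E (\<phi> t)) (at t within {0..1})"
        using trav[unfolded traverses_def, THEN bspec, THEN spec, THEN spec, THEN mp] by simp
      then obtain \<sigma> \<delta> where "\<delta> > 0"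
        and ode: "\<And>t. t \<in> {0..1} \<Longrightarrow> \<bar>t - s\<bar> < \<delta> \<Longrightarrow>
          (\<phi> has_vector_derivative (c * \<sigma>) *\<^sub>R ridge_tangent p E (\<phi> t)) (at t within {0..1})"
        by blast
      obtain B where B: "open B" "{0..1} \<inter> \<phi> -` W = {0..1} \<inter> B"
        using preim[of W] frame unfolding local_frame_def by blast
      \<comment> \<open>The parameters near \<open>s\<close> at which the curve stays in the frame's
        domain \<open>W\<close> and the equation holds with one fixed sign.\<close>
      define J where "J = {0..1} \<inter> (B \<inter> ball s \<delta>)"
      have "Ck_on (Suc n) \<phi> J"
      proof (rule Ck_on_autonomous_ode)
        \<comment> \<open>The scale \<open>c\<close> and the sign \<open>\<sigma>\<close> are
          absorbed into the vector field, which makes the equation autonomous.\<close>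
        show "Ck_on n (\<lambda>x. (c * \<sigma>) *\<^sub>R ridge_tangent p E x) W"
          by (intro Ck_on_scaleR Ck_on_const Ck_on_ridge_tangent[OF frame Ck_on_SucD[OF p]])
        show "\<phi> ` J \<subseteq> W"
          using B by (auto simp: J_def)
        show "(\<phi> has_vector_derivative (c * \<sigma>) *\<^sub>R ridge_tangent p E (\<phi> t)) (at t within J)"
          if "t \<in> J" for t
          using that ode[of t]
          by (auto simp: J_def dist_real_def abs_minus_commute
              intro: has_vector_derivative_within_subset)
      qed
      then have "Ck_on (k - 2) \<phi> (S \<inter> (B \<inter> ball s \<delta>))"
        unfolding Suc by (rule Ck_on_subset) (auto simp: J_def S_def)
      moreover have "s \<in> B"
        using B(2) W s unfolding S_def by blast
      moreover have "open (B \<inter> ball s \<delta>)" "s \<in> ball s \<delta>"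
        using B(1) \<open>\<delta> > 0\<close> by auto
      ultimately show "\<exists>N. open N \<and> s \<in> N \<and> Ck_on (k - 2) \<phi> (S \<inter> N)"
        by blast
    qed
  qed
  then show ?thesis
    by (simp only: S_def)
qed

end
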